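(* For all integers $n\geq 0$, $sp(n)=oc(n)$, and their common generating function is $$\sum_{n\ge 0} sp(n)x^n = 1+\sum_{i=0}^{\infty}\frac{x^{2^i}}{1-x^{2^{i+1}}}\prod_{t=0}^{i-1}\left(1+\frac{2x^{2^t}}{1-x^{2^{t+1}}}\right)=\sum_{n\ge 0} oc(n)x^n.$$
   Context: Semi-Pell compositions: define sets $SP(n)$ of compositions of $n$ recursively by $SP(1)=\{(1)\}$, $SP(2)=\{(2)\}$; for even $n>2$, $SP(n)$ consists of the compositions in $SP(n/2)$ with every part doubled; for odd $n>2$, $SP(n)$ consists of the compositions obtained by inserting a part $1$ at the beginning or at the end of each composition in $SP(n-1)$, together with the compositions obtained by adding $2$ to the odd part of each composition in $SP(n-2)$ (each such composition has exactly one odd part). Let $sp(n)=|SP(n)|$ for $n\ge1$, $sp(0)=1$. Equivalently $sp(0)=sp(1)=1$ and for $n>1$, $sp(n)=sp(n/2)$ if $n$ is even and $sp(n)=2sp(n-1)+sp(n-2)$ if $n$ is odd. $oc(n)$ is the number of weakly unimodal compositions of $n$ into powers of $2$ in which each part size that occurs appears in a single block of consecutive positions and an odd number of times ($oc(0)=1$). A composition is weakly unimodal if it has the form $(a_1,\dots,a_r,c,b_s,\dots,b_1)$ with $a_1\le\cdots\le a_r\le c>b_s\ge\cdots\ge b_1\ge1$ (the $a$'s or $b$'s may be absent). *)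

theory Defs
  imports "HOL-Computational_Algebra.Formal_Power_Series"
begin

definition compositions :: "nat \<Rightarrow> nat list set" where
  "compositions n = {xs. (\<forall>p \<in> set xs. 1 \<le> p) \<and> sum_list xs = n}"

(* SP 0 is a junk value; sp 0 = 1 is set by convention below. For odd n every member of SP n has
   exactly one odd part (SP_one_odd_part), so the map in the last line changes only that part. *)
function SP :: "nat \<Rightarrow> nat list set" where
  "SP n =
    (if n = 0 then {}
     else if n = 1 then {[1]}
     else if n = 2 then {[2]}
     else if even n then map (\<lambda>p. 2 * p) ` SP (n div 2)
     else (\<lambda>xs. 1 # xs) ` SP (n - 1) \<union> (\<lambda>xs. xs @ [1]) ` SP (n - 1) \<union>
          map (\<lambda>p. if odd p then p + 2 else p) ` SP (n - 2))"
  by auto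
termination
  by (relation "measure id") auto

declare SP.simps [simp del]

definition sp :: "nat \<Rightarrow> nat" where
  "sp n = (if n = 0 then 1 else card (SP n))"

definition weakly_unimodal :: "nat list \<Rightarrow> bool" where
  "weakly_unimodal xs \<longleftrightarrow>
    (\<exists>as c bs. xs = as @ [c] @ bs \<and> sorted (as @ [c]) \<and>
       sorted_wrt (\<ge>) bs \<and> (bs \<noteq> [] \<longrightarrow> c > hd bs))"

definition in_single_block :: "nat \<Rightarrow> nat list \<Rightarrow> bool" where
  "in_single_block p xs \<longleftrightarrow> (\<exists>us vs. xs = us @ replicate (count_list xs p) p @ vs)"

definition OC :: "nat \<Rightarrow> nat list set" where
  "OC n = {xs \<in> compositions n. weakly_unimodal xs \<and>
     (\<forall>p \<in> set xs. (\<exists>k. p = 2 ^ k) \<and> in_single_block p xs \<and> odd (count_list xs p))}"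

definition oc :: "nat \<Rightarrow> nat" where
  "oc n = (if n = 0 then 1 else card (OC n))"

lemma SP_base: "SP 0 = {}" "SP 1 = {[1]}" "SP 2 = {[2]}"
  by (subst SP.simps, simp)+

lemma SP_all_even: "xs \<in> SP n \<Longrightarrow> even n \<Longrightarrow> p \<in> set xs \<Longrightarrow> even p"
  by (subst (asm) SP.simps) (auto split: if_splits)

lemma SP_one_odd_part: "xs \<in> SP n \<Longrightarrow> odd n \<Longrightarrow> length (filter odd xs) = 1"
proof (induction n arbitrary: xs rule: less_induct)
  case (less n)
  show ?case
  proof (cases "n = 1")
    case True
    then show ?thesis using less.prems(1) by (simp add: SP_base del: One_nat_def)
  next
    case False
    have n: "n > 2" using False less.prems(2) by (cases n) auto
    have ev: "filter odd ys = []" if "ys \<in> SP (n - 1)" for ys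
      using SP_all_even[OF that] less.prems(2) n by (auto simp: filter_empty_conv)
    have od: "length (filter odd ys) = 1" if "ys \<in> SP (n - 2)" for ys
      using less.IH[of "n - 2" ys] that less.prems(2) n by auto
    have par: "odd (if odd p then p + 2 else p) = odd p" for p :: nat by simp
    have "xs \<in> (\<lambda>xs. 1 # xs) ` SP (n - 1) \<union> (\<lambda>xs. xs @ [1]) ` SP (n - 1) \<union>
          map (\<lambda>p. if odd p then p + 2 else p) ` SP (n - 2)"
      using less.prems n by (subst (asm) SP.simps) (auto split: if_splits)
    then show ?thesis
      by (elim UnE imageE) (simp_all add: ev od filter_map o_def par del: One_nat_def)
  qed
qed

lemma SP_subset_compositions: "SP n \<subseteq> compositions n"
proof (induction n rule: less_induct)
  case (less n)
  show ?case
  proof (cases "n \<le> 2")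
    case True
    then have "n = 0 \<or> n = 1 \<or> n = 2" by auto
    then show ?thesis by (elim disjE) (simp_all add: SP_base compositions_def del: One_nat_def)
  next
    case n: False
    show ?thesis
    proof (cases "even n")
      case True
      have "SP (n div 2) \<subseteq> compositions (n div 2)" using n by (intro less.IH) auto
      moreover have "SP n = map (\<lambda>p. 2 * p) ` SP (n div 2)"
        using n True by (subst SP.simps) auto
      ultimately show ?thesis using True
        by (auto simp: compositions_def sum_list_const_mult subset_iff)
    next
      case False
      have 1: "SP (n - 1) \<subseteq> compositions (n - 1)" using n by (intro less.IH) auto
      have 2: "SP (n - 2) \<subseteq> compositions (n - 2)" using n by (intro less.IH) auto
      have sum: "sum_list (map (\<lambda>p. if odd p then p + 2 else p) ys) =
          sum_list ys + 2 * length (filter odd ys)" for ys :: "nat list"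
        by (induction ys) auto
      have 3: "length (filter odd ys) = 1" if "ys \<in> SP (n - 2)" for ys
        using SP_one_odd_part[OF that] False n by auto
      have "SP n = (\<lambda>xs. 1 # xs) ` SP (n - 1) \<union> (\<lambda>xs. xs @ [1]) ` SP (n - 1) \<union>
          map (\<lambda>p. if odd p then p + 2 else p) ` SP (n - 2)"
        using n False by (subst SP.simps) auto
      then show ?thesis using 1 2 n
        by (auto simp: compositions_def subset_iff sum 3)
    qed
  qed
qed

end

theory Submission
  imports Defs
begin

text \<open>Both sequences satisfy $f(2m) = f(m)$ and $f(2m+3) = 2 f(2m+2) + f(2m+1)$. For $oc$, a
  composition of an even number contains no part 1, so all its parts can be halved; in a
  composition of an odd number $n \ge 3$ the ones form an odd block at one of the two ends, which
  either is a single 1 to be deleted (two choices of the end) or can be shortened by two.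

  For $G(x) = \sum_{n \ge 1} sp(n) x^n$ the recurrence says
  $G(x) = \frac{x}{1-x^2} + \left(1 + \frac{2x}{1-x^2}\right) G(x^2)$. Iterating this $N$ times
  leaves a remainder divisible by $x^{2^N}$, hence the series converges to $G$.\<close>

subsection \<open>The recurrence for $sp$\<close>

text \<open>Adding 2 preserves parity, so the parity of each image entry tells which branch to
  undo.\<close>

lemma inj_map_odd_add_2: "inj (map (\<lambda>p::nat. if odd p then p + 2 else p))"
  by (intro inj_mapI injI) (auto split: if_splits)

lemma inj_map_double: "inj (map (\<lambda>p::nat. 2 * p))"
  by (intro inj_mapI injI) auto

lemma finite_SP: "finite (SP n)"
proof (induction n rule: less_induct)
  case (less n)
  show ?case
    by (subst SP.simps) (auto intro!: less.IH)
qed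

lemma sp_double: "sp (2 * m) = sp m"
\<comment> \<open>The doubling rule of \<open>SP\<close> starts at 4; \<open>SP 2\<close> is a base
  case and \<open>sp 0\<close> a convention, so \<open>m = 0\<close> and \<open>m = 1\<close> are
  separate.\<close>
proof (cases "m \<le> 1")
  case True
  then have "m = 0 \<or> m = 1" by auto
  then show ?thesis
    using SP_base by (auto simp: sp_def)
next
  case False
  then have "SP (2 * m) = map (\<lambda>p. 2 * p) ` SP m"
    by (subst SP.simps) auto
  then show ?thesis
    using False inj_on_subset[OF inj_map_double subset_UNIV] by (simp add: sp_def card_image)
qed

lemma SP_nonempty_list: "xs \<in> SP n \<Longrightarrow> n > 0 \<Longrightarrow> xs \<noteq> []"
  using SP_subset_compositions[of n] by (auto simp: compositions_def)

text \<open>The three families are disjoint: members of \<open>?S\<close> have only even parts, so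
  an inserted 1 is the only 1 and its position separates \<open>?A\<close> from \<open>?B\<close>,
  while lists in \<open>?C\<close> contain no 1 because their odd part has grown by 2.\<close>

lemma sp_odd: "sp (2 * m + 3) = 2 * sp (2 * m + 2) + sp (2 * m + 1)"
proof -
  let ?S = "SP (2 * m + 2)"
  let ?A = "(\<lambda>xs. 1 # xs) ` ?S"
  let ?B = "(\<lambda>xs. xs @ [1]) ` ?S"
  let ?C = "map (\<lambda>p. if odd p then p + 2 else p) ` SP (2 * m + 1)"
  have dec: "2 * m + 3 - 1 = 2 * m + 2" "2 * m + 3 - 2 = 2 * m + 1" by simp_all
  have eq: "SP (2 * m + 3) = ?A \<union> ?B \<union> ?C"
    using SP.simps[of "2 * m + 3"] by (simp add: dec del: One_nat_def)
  have ev: "1 \<notin> set xs" if "xs \<in> ?S" for xs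
    using SP_all_even[OF that, of 1] by auto
  have AB: "?A \<inter> ?B = {}"
  proof (rule ccontr)
    assume "?A \<inter> ?B \<noteq> {}"
    then obtain xs ys where "xs \<in> ?S" "ys \<in> ?S" and e: "1 # xs = ys @ [1]" by auto
    then show False
      using ev[of ys] SP_nonempty_list[of ys "2 * m + 2"] by (cases ys) auto
  qed
  have "1 \<notin> set zs" if "zs \<in> ?C" for zs
    using that by (auto split: if_splits)
  then have ABC: "(?A \<union> ?B) \<inter> ?C = {}"
    by fastforce
  have "card ?A = card ?S" "card ?B = card ?S" "card ?C = card (SP (2 * m + 1))"
    by (auto intro!: card_image inj_onI dest: injD[OF inj_map_odd_add_2])
  then show ?thesis
    using AB ABC by (simp add: sp_def eq card_Un_disjoint finite_SP)
qed

subsection \<open>Unimodality and blocks\<close>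

text \<open>A minimal entry simply extends the rising part, where equality is allowed.\<close>

lemma weakly_unimodal_Cons_min:
  assumes "weakly_unimodal xs" "\<And>p. p \<in> set xs \<Longrightarrow> m \<le> p"
  shows "weakly_unimodal (m # xs)"
proof -
  obtain as c bs where "xs = as @ [c] @ bs" "sorted (as @ [c])"
      "sorted_wrt (\<ge>) bs" "bs \<noteq> [] \<longrightarrow> c > hd bs"
    using assms(1) by (auto simp: weakly_unimodal_def)
  then show ?thesis
    using assms(2) unfolding weakly_unimodal_def
    by (intro exI[of _ "m # as"] exI[of _ c] exI[of _ bs]) auto
qed

text \<open>The head is at most the peak, so the head condition makes the peak exceed
  \<open>m\<close>. Hence \<open>m\<close> can end the falling part even if that part was
  empty.\<close>

lemma weakly_unimodal_snoc_min:
  assumes "weakly_unimodal xs" "\<And>p. p \<in> set xs \<Longrightarrow> m \<le> p" "hd xs \<noteq> m"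
  shows "weakly_unimodal (xs @ [m])"
proof -
  obtain as c bs where *: "xs = as @ [c] @ bs" "sorted (as @ [c])"
      "sorted_wrt (\<ge>) bs" "bs \<noteq> [] \<longrightarrow> c > hd bs"
    using assms(1) by (auto simp: weakly_unimodal_def)
  have "m < c"
  proof (rule ccontr)
    assume "\<not> m < c"
    moreover have "m \<le> hd xs" "hd xs \<le> c" using * assms(2) by (cases as; auto)+
    ultimately show False using assms(3) by simp
  qed
  with * show ?thesis
    using assms(2) unfolding weakly_unimodal_def
    by (intro exI[of _ as] exI[of _ c] exI[of _ "bs @ [m]"])
       (auto simp: sorted_wrt_append hd_append)
qed

lemma weakly_unimodal_ConsD:
  assumes "weakly_unimodal (m # xs)" "\<And>p. p \<in> set xs \<Longrightarrow> m \<le> p" "xs \<noteq> []"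
  shows "weakly_unimodal xs"
proof -
  obtain as c bs where *: "m # xs = as @ [c] @ bs" "sorted (as @ [c])"
      "sorted_wrt (\<ge>) bs" "bs \<noteq> [] \<longrightarrow> c > hd bs"
    using assms(1) by (auto simp: weakly_unimodal_def)
  have "as \<noteq> []"
  proof
    assume "as = []"
    then have "bs \<noteq> []" "xs = bs" "c = m" using * assms(3) by auto
    then show False using *(4) assms(2)[of "hd bs"] by simp
  qed
  then obtain as' where "as = m # as'" using *(1) by (cases as) auto
  with * show ?thesis
    unfolding weakly_unimodal_def
    by (intro exI[of _ as'] exI[of _ c] exI[of _ bs]) auto
qed

lemma weakly_unimodal_snocD:
  assumes "weakly_unimodal (xs @ [x])" "xs \<noteq> []"
  shows "weakly_unimodal xs"
proof -
  obtain as c bs where *: "xs @ [x] = as @ [c] @ bs" "sorted (as @ [c])"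
      "sorted_wrt (\<ge>) bs" "bs \<noteq> [] \<longrightarrow> c > hd bs"
    using assms(1) by (auto simp: weakly_unimodal_def)
  show ?thesis
  proof (cases bs rule: rev_cases)
    case Nil
    \<comment> \<open>Here the removed entry is the peak itself; the last entry of the rising part
      takes its place.\<close>
    then have "xs = as" using *(1) by simp
    then obtain as' c' where "as = as' @ [c']" using assms(2) by (cases as rule: rev_cases) auto
    with * \<open>xs = as\<close> show ?thesis
      unfolding weakly_unimodal_def
      by (intro exI[of _ as'] exI[of _ c'] exI[of _ "[]"]) (auto simp: sorted_append)
  next
    case (snoc bs' b)
    then have "xs = as @ [c] @ bs'" using *(1) by simp
    with * snoc show ?thesis
      unfolding weakly_unimodal_def
      by (intro exI[of _ as] exI[of _ c] exI[of _ bs'])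
         (auto simp: sorted_wrt_append hd_append split: if_splits)
  qed
qed

text \<open>The rising part is smallest at its first entry and the falling part at its last, so a
  minimum that occurs is also attained at an end of the list.\<close>

lemma weakly_unimodal_min_at_end:
  assumes "weakly_unimodal xs" "\<And>p. p \<in> set xs \<Longrightarrow> m \<le> p" "m \<in> set xs"
  shows "hd xs = m \<or> last xs = m"
proof -
  obtain as c bs where *: "xs = as @ [c] @ bs" "sorted (as @ [c])"
      "sorted_wrt (\<ge>) bs"
    using assms(1) by (auto simp: weakly_unimodal_def)
  have "m \<in> set (as @ [c]) \<or> m \<in> set bs" using * assms(3) by auto
  then show ?thesis
  proof
    assume "m \<in> set (as @ [c])"
    then have "hd xs \<le> m" using * by (cases as) auto
    then show ?thesis using assms(2)[of "hd xs"] * by (cases as) auto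
  next
    assume m: "m \<in> set bs"
    then obtain bs' b where "bs = bs' @ [b]" by (cases bs rule: rev_cases) auto
    then have "last xs \<le> m" using * m by (auto simp: sorted_wrt_append)
    then show ?thesis using assms(2)[of "last xs"] * by auto
  qed
qed

lemma weakly_unimodal_map_iff:
  assumes "strict_mono (f :: nat \<Rightarrow> nat)"
  shows "weakly_unimodal (map f xs) \<longleftrightarrow> weakly_unimodal xs"
proof
  assume "weakly_unimodal (map f xs)"
  then obtain as c bs where *: "map f xs = as @ [c] @ bs" "sorted (as @ [c])"
      "sorted_wrt (\<ge>) bs" "bs \<noteq> [] \<longrightarrow> c > hd bs"
    by (auto simp: weakly_unimodal_def)
  from *(1) obtain as' c' bs' where
      "xs = as' @ [c'] @ bs'" "as = map f as'" "c = f c'" "bs = map f bs'"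
    by (auto simp: map_eq_append_conv map_eq_Cons_conv)
  with * show "weakly_unimodal xs"
    using assms unfolding weakly_unimodal_def
    by (intro exI[of _ as'] exI[of _ c'] exI[of _ bs'])
       (auto simp: sorted_map sorted_wrt_map sorted_append
          hd_map strict_mono_less_eq strict_mono_less)
next
  assume "weakly_unimodal xs"
  then obtain as c bs where *: "xs = as @ [c] @ bs" "sorted (as @ [c])"
      "sorted_wrt (\<ge>) bs" "bs \<noteq> [] \<longrightarrow> c > hd bs"
    by (auto simp: weakly_unimodal_def)
  then show "weakly_unimodal (map f xs)"
    using assms unfolding weakly_unimodal_def
    by (intro exI[of _ "map f as"] exI[of _ "f c"] exI[of _ "map f bs"])
       (auto simp: sorted_map sorted_wrt_map sorted_append
          hd_map strict_mono_less_eq strict_mono_less)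
qed

section \<open>Blocks of equal entries under maps, reversal and changes at an end\<close>

lemma in_single_block_map_iff:
  assumes "inj f"
  shows "in_single_block (f p) (map f xs) \<longleftrightarrow> in_single_block p xs"
proof -
  have c: "count_list (map f xs) (f p) = count_list xs p"
    by (rule count_list_map_conv[OF assms])
  have r: "map f ys = replicate k (f p) \<longleftrightarrow> ys = replicate k p" for ys k
    using assms by (metis inj_map_eq_map map_replicate)
  show ?thesis
    unfolding in_single_block_def c
    by (metis append_eq_map_conv map_append r)
qed

lemma in_single_block_rev [simp]: "in_single_block p (rev xs) \<longleftrightarrow> in_single_block p xs"
proof -
  have "in_single_block p (rev xs)" if "in_single_block p xs" for xs
    using that unfolding in_single_block_def
    by (metis append.assoc count_list_rev rev_append rev_replicate)
  from this[of xs] this[of "rev xs"] show ?thesis by auto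
qed

lemma in_single_block_ConsI: "p \<noteq> x \<Longrightarrow> in_single_block p xs \<Longrightarrow> in_single_block p (x # xs)"
  unfolding in_single_block_def by (metis append_Cons count_list.simps(2))

text \<open>Counting \<open>p\<close> on both sides leaves none for the prefix \<open>us\<close>;
  since the list starts with \<open>p\<close>, that prefix is empty.\<close>

lemma in_single_block_front:
  assumes "in_single_block p (p # xs)"
  shows "\<exists>vs. p # xs = replicate (count_list (p # xs) p) p @ vs"
proof -
  obtain us vs where e: "p # xs = us @ replicate (count_list (p # xs) p) p @ vs"
    using assms by (auto simp: in_single_block_def)
  define k where "k = count_list (p # xs) p"
  have "count_list (replicate k p) p = k"
    by (induction k) simp_all
  then have "k = count_list us p + k + count_list vs p"
    using arg_cong[OF e, of "\<lambda>l. count_list l p"] unfolding k_def[symmetric]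
    by simp
  then have "p \<notin> set us" by (simp add: count_list_0_iff)
  then have "us = []" using e by (cases us) auto
  then show ?thesis using e by auto
qed

lemma in_single_block_ConsD:
  assumes "in_single_block p (x # xs)"
  shows "in_single_block p xs"
proof (cases "p = x")
  case True
  then show ?thesis
    using in_single_block_front[of x xs] assms unfolding in_single_block_def
    by (metis append_Nil append_Cons count_list.simps(2) list.inject replicate_Suc Suc_eq_plus1)
next
  case False
  obtain us vs where e: "x # xs = us @ replicate (count_list xs p) p @ vs"
    using assms False by (auto simp: in_single_block_def)
  show ?thesis
  \<comment> \<open>If \<open>p\<close> does not occur, its block is empty and \<open>us\<close> may
    be empty too, so \<open>x\<close> need not come from \<open>us\<close>; an empty block fits
    anywhere.\<close>
  proof (cases "count_list xs p = 0")
    case True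
    then show ?thesis by (auto simp: in_single_block_def)
  next
    case pos: False
    then show ?thesis using e False
      by (cases us; cases "count_list xs p") (auto simp: in_single_block_def)
  qed
qed

lemma in_single_block_Cons2I:
  assumes "in_single_block p (p # xs)"
  shows "in_single_block p (p # p # xs)"
  using in_single_block_front[OF assms] unfolding in_single_block_def
  by (metis append_Nil append_Cons count_list.simps(2) replicate_Suc Suc_eq_plus1)

text \<open>Reversal turns questions about the end of a list into questions about its front, so the
  Cons lemmas serve both ends.\<close>

lemma in_single_block_snoc: "in_single_block p (xs @ [x]) \<longleftrightarrow> in_single_block p (x # rev xs)"
  using in_single_block_rev[of p "xs @ [x]"] by simp

lemma in_single_block_new: "x \<notin> set xs \<Longrightarrow> in_single_block x (x # xs)"
  unfolding in_single_block_def by (intro exI[of _ "[]"] exI[of _ xs]) simp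

subsection \<open>The recurrence for $oc$\<close>

text \<open>This is membership in \<open>OC\<close> without the sum, so that parts can be added,
  removed and doubled first and the sum checked afterwards.\<close>

definition odd_blocks :: "nat list \<Rightarrow> bool" where
  "odd_blocks xs \<longleftrightarrow> weakly_unimodal xs \<and>
     (\<forall>p \<in> set xs. (\<exists>k. p = 2 ^ k) \<and> in_single_block p xs \<and> odd (count_list xs p))"

text \<open>Powers of 2 are positive, which gives the positivity required by
  \<open>compositions\<close>.\<close>

lemma OC_iff: "xs \<in> OC n \<longleftrightarrow> odd_blocks xs \<and> sum_list xs = n"
  by (fastforce simp: OC_def odd_blocks_def compositions_def)

text \<open>A peak must exist. Hence \<open>OC 0\<close> is empty and \<open>oc 0 = 1\<close> comes
  from the convention in \<open>oc\<close>.\<close>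

lemma odd_blocks_nonempty: "odd_blocks xs \<Longrightarrow> xs \<noteq> []"
  by (auto simp: odd_blocks_def weakly_unimodal_def)

lemma odd_blocks_ge_1: "odd_blocks xs \<Longrightarrow> p \<in> set xs \<Longrightarrow> 1 \<le> p"
  by (fastforce simp: odd_blocks_def)

section \<open>Adding ones at either end\<close>

lemma odd_blocks_Cons_1:
  assumes "odd_blocks xs" "1 \<notin> set xs"
  shows "odd_blocks (1 # xs)"
  using assms odd_blocks_ge_1[OF assms(1)] unfolding odd_blocks_def
  by (auto intro!: weakly_unimodal_Cons_min in_single_block_new intro: in_single_block_ConsI exI[of _ 0])

lemma odd_blocks_snoc_1:
  assumes "odd_blocks xs" "1 \<notin> set xs"
  shows "odd_blocks (xs @ [1])"
proof -
  have "hd xs \<noteq> 1" using assms odd_blocks_nonempty[of xs] by (metis hd_in_set)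
  then show ?thesis
    using assms odd_blocks_ge_1[OF assms(1)] unfolding odd_blocks_def
    by (auto intro!: weakly_unimodal_snoc_min in_single_block_new simp: in_single_block_snoc
         intro: in_single_block_ConsI exI[of _ 0])
qed

text \<open>Two ones leave the parity of the count unchanged, and next to the ones already in front
  they stay in a single block.\<close>

lemma odd_blocks_Cons_1_1:
  assumes "odd_blocks xs" "hd xs = 1"
  shows "odd_blocks (1 # 1 # xs)"
proof -
  obtain ys where xs: "xs = 1 # ys"
    using assms odd_blocks_nonempty[of xs] by (cases xs) auto
  have "weakly_unimodal (1 # 1 # xs)"
    using assms odd_blocks_ge_1[OF assms(1)]
    by (intro weakly_unimodal_Cons_min) (auto simp: odd_blocks_def)
  moreover have "in_single_block 1 (1 # 1 # xs)"
    using assms(1) unfolding xs odd_blocks_def by (intro in_single_block_Cons2I) simp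
  ultimately show ?thesis
    using assms by (auto simp: odd_blocks_def xs intro: in_single_block_ConsI exI[of _ 0])
qed

lemma odd_blocks_snoc_1_1:
  assumes "odd_blocks xs" "1 \<in> set xs" "hd xs \<noteq> 1"
  shows "odd_blocks (xs @ [1, 1])"
proof -
  note ge = odd_blocks_ge_1[OF assms(1)]
  have wu: "weakly_unimodal xs" and ne: "xs \<noteq> []"
    using assms(1) odd_blocks_nonempty by (auto simp: odd_blocks_def)
  \<comment> \<open>Ones are minimal and not at the front, so they reach the back.\<close>
  have "last xs = 1"
    using weakly_unimodal_min_at_end[of xs 1] assms ge wu by auto
  then obtain ys where xs: "xs = ys @ [1]"
    using ne by (metis append_butlast_last_id)
  have "weakly_unimodal (xs @ [1])"
    using wu ge assms(3) by (intro weakly_unimodal_snoc_min)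
  \<comment> \<open>The first appended 1 does not change the head, as \<open>xs\<close> is nonempty,
    so the head condition holds again.\<close>
  then have wu': "weakly_unimodal ((xs @ [1]) @ [1])"
    by (rule weakly_unimodal_snoc_min) (use ge assms(3) ne in auto)
  have block: "in_single_block p (xs @ [1, 1]) \<longleftrightarrow> in_single_block p (1 # 1 # rev xs)" for p
    using in_single_block_snoc[of p "xs @ [1]" 1] by simp
  have "in_single_block 1 (1 # rev ys)"
    using assms(1,2) in_single_block_snoc[of 1 ys 1] by (simp add: odd_blocks_def xs)
  then have "in_single_block 1 (xs @ [1, 1])"
    unfolding block by (simp add: xs in_single_block_Cons2I)
  moreover have "in_single_block p (xs @ [1, 1])" if "p \<noteq> 1" "p \<in> set xs" for p
    using assms(1) that unfolding block by (auto simp: odd_blocks_def intro!: in_single_block_ConsI)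
  ultimately have "in_single_block p (xs @ [1, 1])" if "p \<in> set xs" for p
    using that by (cases "p = 1") auto
  then show ?thesis
    using assms(1,2) wu' by (auto simp: odd_blocks_def)
qed

section \<open>Removing ones at either end\<close>

lemma odd_blocks_Cons_1D:
  assumes "odd_blocks (1 # xs)" "1 \<notin> set xs" "xs \<noteq> []"
  shows "odd_blocks xs"
proof -
  have "weakly_unimodal xs"
    by (rule weakly_unimodal_ConsD[of 1])
       (use assms odd_blocks_ge_1[OF assms(1)] in \<open>auto simp: odd_blocks_def\<close>)
  moreover have "in_single_block p xs" if "p \<in> set xs" for p
    using assms(1) that in_single_block_ConsD[of p 1 xs] by (simp add: odd_blocks_def)
  ultimately show ?thesis
    using assms by (auto simp: odd_blocks_def split: if_splits)
qed

lemma odd_blocks_snoc_1D: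
  assumes "odd_blocks (xs @ [1])" "1 \<notin> set xs" "xs \<noteq> []"
  shows "odd_blocks xs"
proof -
  have "weakly_unimodal xs"
    using assms by (intro weakly_unimodal_snocD[of xs 1]) (auto simp: odd_blocks_def)
  moreover have "in_single_block p xs" if "p \<in> set xs" for p
    using assms(1) that in_single_block_ConsD[of p 1 "rev xs"]
    by (auto simp: odd_blocks_def in_single_block_snoc)
  ultimately show ?thesis
    using assms by (auto simp: odd_blocks_def split: if_splits)
qed

text \<open>Removing two ones keeps the parity of their count; the other counts do not
  change.\<close>

lemma odd_blocks_Cons_1_1D:
  assumes "odd_blocks (1 # 1 # xs)" "xs \<noteq> []"
  shows "odd_blocks xs"
proof -
  have "weakly_unimodal (1 # xs)"
    by (rule weakly_unimodal_ConsD[of 1])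
       (use assms odd_blocks_ge_1[OF assms(1)] in \<open>auto simp: odd_blocks_def\<close>)
  then have "weakly_unimodal xs"
    by (rule weakly_unimodal_ConsD) (use assms odd_blocks_ge_1[OF assms(1)] in auto)
  moreover have "in_single_block p xs" if "p \<in> set xs" for p
  proof -
    have "in_single_block p (1 # 1 # xs)"
      using assms(1) that by (simp add: odd_blocks_def)
    then show ?thesis using in_single_block_ConsD by blast
  qed
  ultimately show ?thesis
    using assms by (auto simp: odd_blocks_def split: if_splits)
qed

lemma odd_blocks_snoc_1_1D:
  assumes "odd_blocks (xs @ [1, 1])" "xs \<noteq> []"
  shows "odd_blocks xs"
proof -
  have "weakly_unimodal (xs @ [1])"
    using assms by (intro weakly_unimodal_snocD[of "xs @ [1]" 1]) (auto simp: odd_blocks_def)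
  then have "weakly_unimodal xs"
    using assms(2) by (rule weakly_unimodal_snocD)
  moreover have "in_single_block p xs" if "p \<in> set xs" for p
  proof -
    have "in_single_block p (1 # 1 # rev xs)"
      using assms(1) that in_single_block_snoc[of p "xs @ [1]" 1] by (simp add: odd_blocks_def)
    then show ?thesis
      using in_single_block_ConsD in_single_block_rev by blast
  qed
  ultimately show ?thesis
    using assms by (auto simp: odd_blocks_def split: if_splits)
qed

section \<open>Parity of the sum and doubling\<close>

text \<open>The only odd power of 2 is 1, so only the ones affect the parity of the sum.\<close>

lemma powers_of_2_parity:
  assumes "\<And>p. p \<in> set xs \<Longrightarrow> \<exists>k. p = (2::nat) ^ k"
  shows "even (sum_list xs) \<longleftrightarrow> even (count_list xs 1)"
  using assms
proof (induction xs)
  case (Cons a xs)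
  obtain k where "a = 2 ^ k" using Cons.prems[of a] by auto
  then show ?case using Cons by (cases k) auto
qed simp

text \<open>If 1 occurs at all, it occurs an odd number of times, so an even count means that there
  is none.\<close>

lemma odd_blocks_even_sum: "odd_blocks xs \<Longrightarrow> even (sum_list xs) \<longleftrightarrow> 1 \<notin> set xs"
  using powers_of_2_parity[of xs] unfolding odd_blocks_def by fastforce

lemma odd_blocks_double: "odd_blocks (map (\<lambda>p. 2 * p) xs) \<longleftrightarrow> odd_blocks xs \<and> 0 \<notin> set xs"
proof -
  have inj: "inj (\<lambda>p::nat. 2 * p)" by (intro injI) simp
  have pow: "(\<exists>k. 2 * p = (2::nat) ^ k) \<longleftrightarrow> (\<exists>k. p = 2 ^ k)" for p
  proof
    assume "\<exists>k. 2 * p = 2 ^ k"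
    then obtain k where "2 * p = 2 ^ k" by auto
    \<comment> \<open>For \<open>k = 0\<close> the even number \<open>2 * p\<close> would be 1;
      otherwise a factor 2 cancels.\<close>
    then show "\<exists>k. p = 2 ^ k" by (cases k) (use odd_one in \<open>fastforce\<close>)+
  qed (metis power_Suc)
  show ?thesis
    using count_list_map_conv[OF inj] in_single_block_map_iff[OF inj]
      weakly_unimodal_map_iff[of "\<lambda>p::nat. 2 * p"]
    by (auto simp: odd_blocks_def strict_mono_def pow)
qed

lemma OC_double: "OC (2 * m) = map (\<lambda>p. 2 * p) ` OC m"
proof (intro equalityI subsetI)
  fix xs assume xs: "xs \<in> OC (2 * m)"
  then have *: "odd_blocks xs" "sum_list xs = 2 * m" by (auto simp: OC_iff)
  have one: "1 \<notin> set xs" using odd_blocks_even_sum[OF *(1)] *(2) by simp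
  have "even p" if p: "p \<in> set xs" for p
  proof -
    obtain k where "p = 2 ^ k" using *(1) p by (auto simp: odd_blocks_def)
    then show ?thesis using one p by (cases k) auto
  qed
  \<comment> \<open>All parts are even, so halving loses nothing and \<open>ys\<close> below is the
    required preimage.\<close>
  then have e: "map (\<lambda>p. 2 * p) (map (\<lambda>p. p div 2) xs) = xs"
    by (simp add: map_idI)
  define ys where "ys = map (\<lambda>p. p div 2) xs"
  have ys: "xs = map (\<lambda>p. 2 * p) ys" unfolding ys_def e ..
  have "odd_blocks ys" using *(1) unfolding ys odd_blocks_double by simp
  moreover have "sum_list ys = m"
    using *(2) unfolding ys by (simp add: sum_list_const_mult)
  ultimately show "xs \<in> map (\<lambda>p. 2 * p) ` OC m"
    unfolding ys by (intro imageI) (simp add: OC_iff)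
next
  fix xs assume "xs \<in> map (\<lambda>p. 2 * p) ` OC m"
  then show "xs \<in> OC (2 * m)"
    using odd_blocks_ge_1
    by (fastforce simp: OC_iff odd_blocks_double sum_list_const_mult)
qed

text \<open>The ones of a composition in $OC(n)$ with $n$ odd form one block at the beginning or at the
  end, and \<open>add_two_ones\<close> lengthens that block; on other lists its value is irrelevant.\<close>

definition add_two_ones :: "nat list \<Rightarrow> nat list" where
  "add_two_ones xs = (if hd xs = 1 then 1 # 1 # xs else xs @ [1, 1])"

text \<open>For nonempty lists the result starts with 1 exactly if the argument does, so its head
  reveals the branch.\<close>

lemma add_two_ones_inj: "inj_on add_two_ones {xs. xs \<noteq> []}"
proof (rule inj_onI)
  fix xs ys :: "nat list"
  assume "xs \<in> {xs. xs \<noteq> []}" "ys \<in> {xs. xs \<noteq> []}" "add_two_ones xs = add_two_ones ys"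
  then show "xs = ys"
    by (cases xs; cases ys) (auto simp: add_two_ones_def split: if_splits)
qed

text \<open>The number \<open>k\<close> of ones is odd. For \<open>k = 1\<close> the end holding the
  1 selects \<open>?A\<close> or \<open>?B\<close>; for larger \<open>k\<close> the block loses two
  ones and the list lies in \<open>?C\<close>.\<close>

lemma OC_odd:
  "OC (2 * m + 3) = (\<lambda>xs. 1 # xs) ` OC (2 * m + 2) \<union> (\<lambda>xs. xs @ [1]) ` OC (2 * m + 2) \<union>
     add_two_ones ` OC (2 * m + 1)" (is "_ = ?A \<union> ?B \<union> ?C")
proof (intro equalityI subsetI)
  fix xs assume "xs \<in> OC (2 * m + 3)"
  then have xs: "odd_blocks xs" "sum_list xs = 2 * m + 3" by (auto simp: OC_iff)
  then have one: "1 \<in> set xs" using odd_blocks_even_sum[of xs] by auto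
  define k where "k = count_list xs 1"
  have k: "odd k" "in_single_block 1 xs" using xs(1) one by (auto simp: odd_blocks_def k_def)
  have ends: "hd xs = 1 \<or> last xs = 1"
    using weakly_unimodal_min_at_end[of xs 1] xs(1) one odd_blocks_ge_1[of xs]
    by (auto simp: odd_blocks_def)
  note ne = odd_blocks_nonempty[OF xs(1)]
  show "xs \<in> ?A \<union> ?B \<union> ?C"
  proof (cases "hd xs = 1")
    case True
    then obtain ys where ys: "xs = 1 # ys" using ne by (cases xs) auto
    show ?thesis
    proof (cases "k = 1")
      case True
      then have "1 \<notin> set ys" using ys by (auto simp: k_def count_list_0_iff)
      \<comment> \<open>The sum is at least 3, which rules out \<open>[1]\<close>.\<close>
      moreover have "ys \<noteq> []" using xs(2) ys by auto
      ultimately have "odd_blocks ys" using xs(1) ys by (auto intro: odd_blocks_Cons_1D)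
      then have "ys \<in> OC (2 * m + 2)" using xs(2) ys by (simp add: OC_iff)
      then show ?thesis using ys by auto
    next
      case False
      \<comment> \<open>With at least three ones, a 1 remains at the head after two are removed, so
        \<open>add_two_ones\<close> puts them back in front.\<close>
      then have "\<exists>j. k = j + 3" using k(1) by presburger
      then obtain j where j: "k = Suc (Suc (Suc j))" by (auto simp: eval_nat_numeral)
      obtain vs where "xs = replicate k 1 @ vs"
        using in_single_block_front[of 1 ys] k(2) ys by (auto simp: k_def)
      then have zs: "xs = 1 # 1 # 1 # (replicate j 1 @ vs)" (is "_ = 1 # 1 # ?zs")
        by (simp add: j)
      have "odd_blocks ?zs"
        by (rule odd_blocks_Cons_1_1D) (use xs(1) zs in auto)
      then have "?zs \<in> OC (2 * m + 1)" using xs(2) zs by (simp add: OC_iff)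
      moreover have "xs = add_two_ones ?zs" by (simp add: zs add_two_ones_def)
      ultimately show ?thesis by blast
    qed
  next
    case hd: False
    then obtain ys where ys: "xs = ys @ [1]" using ends ne by (metis append_butlast_last_id)
    show ?thesis
    proof (cases "k = 1")
      case True
      then have "1 \<notin> set ys" using ys by (auto simp: k_def count_list_0_iff)
      moreover have "ys \<noteq> []" using xs(2) ys by auto
      ultimately have "odd_blocks ys" using xs(1) ys by (auto intro: odd_blocks_snoc_1D)
      then have "ys \<in> OC (2 * m + 2)" using xs(2) ys by (simp add: OC_iff)
      then show ?thesis using ys by auto
    next
      case False
      then have "\<exists>j. k = j + 3" using k(1) by presburger
      then obtain j where j: "k = Suc (Suc (Suc j))" by (auto simp: eval_nat_numeral)
      obtain vs where "rev xs = replicate k 1 @ vs"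
        using in_single_block_front[of 1 "rev ys"] k(2) ys in_single_block_snoc[of 1 ys 1]
        by (auto simp: k_def)
      then have "rev xs = 1 # 1 # (replicate (Suc j) 1 @ vs)"
        by (simp add: j)
      then have "xs = rev (1 # 1 # (replicate (Suc j) 1 @ vs))"
        by (metis rev_rev_ident)
      then have zs: "xs = rev (replicate (Suc j) 1 @ vs) @ [1, 1]" (is "_ = ?zs @ _")
        by simp
      have ne': "?zs \<noteq> []" by simp
      have "odd_blocks ?zs"
        using xs(1) ne' unfolding zs by (rule odd_blocks_snoc_1_1D)
      then have "?zs \<in> OC (2 * m + 1)" using xs(2) zs by (simp add: OC_iff)
      \<comment> \<open>Dropping the last two entries keeps the head of a list with nonempty rest,
        so \<open>add_two_ones\<close> takes its second branch.\<close>
      moreover have "hd ?zs \<noteq> 1" using hd ne' zs by (metis hd_append2)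
      then have "xs = add_two_ones ?zs" using zs by (simp add: add_two_ones_def)
      ultimately show ?thesis by blast
    qed
  qed
next
  fix xs assume "xs \<in> ?A \<union> ?B \<union> ?C"
  then show "xs \<in> OC (2 * m + 3)"
  proof (elim UnE imageE)
    fix ys assume ys: "ys \<in> OC (2 * m + 2)"
    then have 1: "1 \<notin> set ys" "odd_blocks ys" "sum_list ys = 2 * m + 2"
      using odd_blocks_even_sum[of ys] by (auto simp: OC_iff)
    show "xs \<in> OC (2 * m + 3)" if "xs = 1 # ys"
      using 1 odd_blocks_Cons_1[of ys] that by (simp add: OC_iff)
    show "xs \<in> OC (2 * m + 3)" if "xs = ys @ [1]"
      using 1 odd_blocks_snoc_1[of ys] that by (simp add: OC_iff)
  next
    fix ys assume ys: "ys \<in> OC (2 * m + 1)" and e: "xs = add_two_ones ys"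
    then have 1: "1 \<in> set ys" "odd_blocks ys" "sum_list ys = 2 * m + 1"
      using odd_blocks_even_sum[of ys] by (auto simp: OC_iff)
    show "xs \<in> OC (2 * m + 3)"
    proof (cases "hd ys = 1")
      case True
      then show ?thesis
        using odd_blocks_Cons_1_1[OF 1(2)] 1(3) by (simp add: OC_iff e add_two_ones_def)
    next
      case False
      then show ?thesis
        using odd_blocks_snoc_1_1[OF 1(2,1)] 1(3) by (simp add: OC_iff e add_two_ones_def)
    qed
  qed
qed

lemma OC_1: "OC 1 = {[1]}"
proof (rule equalityI)
  show "OC 1 \<subseteq> {[1]}"
  proof
    fix xs assume "xs \<in> OC 1"
    then have xs: "odd_blocks xs" "sum_list xs = 1" by (simp_all add: OC_iff)
    obtain a ys where a: "xs = a # ys" using odd_blocks_nonempty[OF xs(1)] by (cases xs) simp_all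
    have "1 \<le> a" using odd_blocks_ge_1[OF xs(1), of a] a by simp
    moreover have "1 \<le> b" if "ys = b # zs" for b zs
      using odd_blocks_ge_1[OF xs(1), of b] a that by simp
    ultimately have "a = 1 \<and> ys = []"
      using xs(2) a by (cases ys) simp_all
    then show "xs \<in> {[1]}" using a by simp
  qed
next
  have "weakly_unimodal [1]"
    unfolding weakly_unimodal_def by (intro exI[of _ "[]"] exI[of _ 1]) simp
  moreover have "\<exists>k. (1::nat) = 2 ^ k"
    by (rule exI[of _ 0]) simp
  ultimately show "{[1]} \<subseteq> OC 1"
    using in_single_block_new[of 1 "[]"] by (simp add: OC_iff odd_blocks_def del: One_nat_def)
qed

section \<open>Counting \<open>OC\<close> and comparison with \<open>sp\<close>\<close>

lemma oc_double: "oc (2 * m) = oc m"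
proof -
  have "card (OC (2 * m)) = card (OC m)"
    unfolding OC_double by (rule card_image, rule inj_on_subset[OF inj_map_double subset_UNIV])
  then show ?thesis by (simp add: oc_def)
qed

text \<open>This is the case split of both recurrences; \<open>0 < m\<close> ensures that halving
  decreases the argument.\<close>

lemma nat_parity_cases:
  obtains "n = 0" | "n = (1::nat)" | m where "n = 2 * m" "0 < m" | m where "n = 2 * m + 3"
proof (cases "even n")
  case True
  then obtain m where "n = 2 * m" by (elim evenE)
  then show ?thesis using that(1,3) by (cases "m = 0") simp_all
next
  case False
  then obtain m where m: "n = 2 * m + 1" by (elim oddE)
  show ?thesis
  proof (cases m)
    case 0
    then show ?thesis using m that(2) by simp
  next
    case (Suc l)
    then show ?thesis using m that(4)[of l] by simp
  qed
qed

text \<open>Each step builds \<open>OC n\<close> from smaller cases by images and unions. At 0 the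
  doubling step would not descend.\<close>

lemma finite_OC: "n > 0 \<Longrightarrow> finite (OC n)"
proof (induction n rule: less_induct)
  case (less n)
  then show ?case
    by (cases n rule: nat_parity_cases) (auto simp: OC_double OC_odd OC_1 simp del: One_nat_def)
qed

text \<open>The number of ones separates the families: exactly one in \<open>?A\<close> and
  \<open>?B\<close>, more in \<open>?C\<close>, where two are added to a list already containing 1.
  As in \<open>sp_odd\<close>, the position of the 1 separates \<open>?A\<close> from
  \<open>?B\<close>.\<close>

lemma oc_odd: "oc (2 * m + 3) = 2 * oc (2 * m + 2) + oc (2 * m + 1)"
proof -
  let ?S = "OC (2 * m + 2)"
  let ?A = "(\<lambda>xs. 1 # xs) ` ?S"
  let ?B = "(\<lambda>xs. xs @ [1]) ` ?S"
  let ?C = "add_two_ones ` OC (2 * m + 1)"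
  have ev: "1 \<notin> set xs \<and> xs \<noteq> []" if "xs \<in> ?S" for xs
    using that odd_blocks_even_sum[of xs] odd_blocks_nonempty[of xs] by (simp add: OC_iff)
  have AB: "?A \<inter> ?B = {}"
  proof (rule ccontr)
    assume "?A \<inter> ?B \<noteq> {}"
    then obtain xs ys where "xs \<in> ?S" "ys \<in> ?S" and e: "1 # xs = ys @ [1]" by auto
    then show False
      using ev[of ys] by (cases ys) auto
  qed
  have "count_list zs 1 = 1" if "zs \<in> ?A \<union> ?B" for zs
    using that ev by auto
  moreover have "count_list zs 1 \<noteq> 1" if zs: "zs \<in> ?C" for zs
  proof -
    obtain ys where ys: "ys \<in> OC (2 * m + 1)" "zs = add_two_ones ys" using zs by auto
    then have "1 \<in> set ys" using odd_blocks_even_sum[of ys] by (auto simp: OC_iff)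
    then show ?thesis by (auto simp: ys(2) add_two_ones_def count_list_0_iff)
  qed
  ultimately have ABC: "(?A \<union> ?B) \<inter> ?C = {}" by blast
  have "OC (2 * m + 1) \<subseteq> {xs. xs \<noteq> []}"
    using odd_blocks_nonempty by (auto simp: OC_iff)
  then have "card ?C = card (OC (2 * m + 1))"
    by (intro card_image inj_on_subset[OF add_two_ones_inj])
  moreover have "card ?A = card ?S" "card ?B = card ?S"
    by (auto intro!: card_image inj_onI)
  moreover have "finite ?A" "finite ?B" "finite ?C"
    by (intro finite_imageI finite_OC, simp)+
  ultimately have "card (?A \<union> ?B \<union> ?C) = card ?S + card ?S + card (OC (2 * m + 1))"
    using AB ABC by (simp only: card_Un_disjoint finite_Un)
  then show ?thesis
    unfolding OC_odd[symmetric] by (simp add: oc_def)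
qed

lemma sp_eq_oc: "sp n = oc n"
proof (induction n rule: less_induct)
  case (less n)
  then show ?case
  proof (cases n rule: nat_parity_cases)
    case 1
    then show ?thesis by (simp add: sp_def oc_def)
  next
    case 2
    then show ?thesis using OC_1 SP_base(2) by (simp add: sp_def oc_def)
  next
    case (3 m)
    then show ?thesis using less.IH[of m] by (simp add: sp_double oc_double)
  next
    case (4 m)
    then show ?thesis
      using less.IH[of "2 * m + 2"] less.IH[of "2 * m + 1"] by (simp only: sp_odd oc_odd)
  qed
qed

subsection \<open>The generating function\<close>

unbundle fps_syntax

text \<open>The \<open>i\<close>-th term of the composition contributes only at
  \<open>k * i\<close>, and \<open>k > 0\<close> makes \<open>i\<close> unique.\<close>

lemma fps_compose_X_power_nth:
  fixes f :: "'a :: comm_ring_1 fps"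
  assumes "k > 0"
  shows "(f oo fps_X ^ k) $ n = (if k dvd n then f $ (n div k) else 0)"
proof -
  have "(f oo fps_X ^ k) $ n = (\<Sum>i = 0..n. if n = k * i then f $ i else 0)"
    by (auto simp: fps_compose_nth power_mult[symmetric] intro!: sum.cong)
  also have "\<dots> = (\<Sum>i \<in> {i \<in> {0..n}. n = k * i}. f $ i)"
    by (rule sum.inter_filter[symmetric]) simp
  also have "{i \<in> {0..n}. n = k * i} = (if k dvd n then {n div k} else {})"
    using assms by (auto simp: div_le_dividend)
  finally show ?thesis by simp
qed

text \<open>The series \<open>G\<close> of the overview. Its constant coefficient is 0, so
  substituting a high power of \<open>fps_X\<close> kills all low coefficients.\<close>

definition sp_fps :: "rat fps" where
  "sp_fps = Abs_fps (\<lambda>n. of_nat (sp n)) - 1"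

lemma sp_fps_nth: "sp_fps $ n = (if n = 0 then 0 else of_nat (sp n))"
  by (simp add: sp_fps_def sp_def)

text \<open>With the denominator cleared, coefficients can be compared: even indices reduce to
  \<open>sp_double\<close>, index \<open>2 * m + 3\<close> to \<open>sp_odd\<close> with
  \<open>sp (2 * m + 2) = sp (m + 1)\<close>, and the summand \<open>fps_X\<close> supplies
  \<open>sp 1\<close>.\<close>

lemma sp_fps_equation:
  "(1 - fps_X ^ 2) * sp_fps =
     (1 - fps_X ^ 2 + 2 * fps_X) * (sp_fps oo fps_X ^ 2) + fps_X"
proof -
  let ?H = "sp_fps oo fps_X ^ 2"
  have H: "?H $ n = (if even n then sp_fps $ (n div 2) else 0)" for n
    by (simp add: fps_compose_X_power_nth)
  have "sp 1 = 1" by (simp add: sp_def SP_base(2) del: One_nat_def)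
  note nth = H fps_X_power_mult_nth fps_X_mult_nth sp_fps_nth
  have "sp_fps - fps_X ^ 2 * sp_fps = ?H - fps_X ^ 2 * ?H + 2 * (fps_X * ?H) + fps_X"
  proof (rule fps_ext)
    fix n
    show "(sp_fps - fps_X ^ 2 * sp_fps) $ n =
        (?H - fps_X ^ 2 * ?H + 2 * (fps_X * ?H) + fps_X) $ n"
    proof (cases n rule: nat_parity_cases)
      case 1
      then show ?thesis by (simp add: nth numeral_fps_const)
    next
      case 2
      then show ?thesis using \<open>sp 1 = 1\<close> by (simp add: nth numeral_fps_const)
    next
      case (3 m)
      then show ?thesis
      \<comment> \<open>At \<open>n = 2\<close> the shift by \<open>fps_X ^ 2\<close> reads the
        constant coefficient, which is 0 and not \<open>sp 0\<close>.\<close>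
      proof (cases "m = 1")
        case True
        then show ?thesis using 3 sp_double[of 1] by (simp add: nth numeral_fps_const)
      next
        case False
        then obtain l where "m = Suc (Suc l)" using 3 by (metis One_nat_def gr0_conv_Suc not0_implies_Suc)
        then show ?thesis using 3 sp_double[of m] sp_double[of "Suc l"]
          by (simp add: nth numeral_fps_const)
      qed
    next
      case (4 m)
      then show ?thesis
        using sp_odd[of m] sp_double[of "Suc m"] by (simp add: nth numeral_fps_const numeral_3_eq_3)
    qed
  qed
  then show ?thesis by (simp add: algebra_simps)
qed

section \<open>Iterating the functional equation\<close>

text \<open>Substituting \<open>fps_X ^ (2 ^ i)\<close> into the equation turns its square into the
  next power \<open>fps_X ^ (2 ^ (i + 1))\<close>, so the equations for successive \<open>i\<close>
  chain together.\<close>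

lemma sp_fps_equation_power:
  "sp_fps oo fps_X ^ (2 ^ i) = fps_X ^ (2 ^ i) / (1 - fps_X ^ (2 ^ (i + 1))) +
     (1 + 2 * fps_X ^ (2 ^ i) / (1 - fps_X ^ (2 ^ (i + 1)))) * (sp_fps oo fps_X ^ (2 ^ (i + 1)))"
proof -
  let ?X = "fps_X ^ (2 ^ i) :: rat fps"
  let ?D = "1 - fps_X ^ (2 ^ (i + 1)) :: rat fps"
  have X0: "?X $ 0 = 0" by simp
  have X2: "fps_X ^ 2 oo ?X = fps_X ^ (2 ^ (i + 1))"
    by (simp add: fps_compose_power[OF X0, symmetric] power_mult[symmetric] mult.commute)
  have two: "2 oo ?X = 2"
    by (simp add: numeral_fps_const)
  have H: "(sp_fps oo fps_X ^ 2) oo ?X = sp_fps oo fps_X ^ (2 ^ (i + 1))"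
    using fps_compose_assoc[OF X0, of "fps_X ^ 2" sp_fps] X2 by simp
  have "((1 - fps_X ^ 2) * sp_fps) oo ?X =
     ((1 - fps_X ^ 2 + 2 * fps_X) * (sp_fps oo fps_X ^ 2) + fps_X) oo ?X"
    by (simp only: sp_fps_equation)
  then have eq: "?D * (sp_fps oo ?X) = (?D + 2 * ?X) * (sp_fps oo fps_X ^ (2 ^ (i + 1))) + ?X"
    by (simp only: fps_compose_mult_distrib[OF X0] fps_compose_add_distrib fps_compose_sub_distrib
          X2 H two fps_compose_1 fps_X_fps_compose_startby0[OF X0])
  \<comment> \<open>The constant coefficient is 1, so \<open>?D\<close> is invertible and division
    by it is multiplication by \<open>inverse ?D\<close>.\<close>
  have D0: "?D $ 0 \<noteq> 0" by simp
  have inv: "inverse ?D * ?D = 1"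
    by (rule inverse_mult_eq_1[OF D0])
  have div: "f / ?D = f * inverse ?D" for f
    by (rule fps_divide_unit[OF D0])
  have "sp_fps oo ?X = inverse ?D * ?D * (sp_fps oo ?X)"
    by (simp only: inv mult_1)
  also have "\<dots> = inverse ?D * ((?D + 2 * ?X) * (sp_fps oo fps_X ^ (2 ^ (i + 1))) + ?X)"
    by (simp only: eq mult.assoc)
  also have "\<dots> = ?X * inverse ?D +
      (inverse ?D * ?D + 2 * ?X * inverse ?D) * (sp_fps oo fps_X ^ (2 ^ (i + 1)))"
    by (simp only: algebra_simps)
  finally show ?thesis
    by (simp only: inv div)
qed

lemma sums_sp_fps:
  defines "T \<equiv> (\<lambda>i. fps_X ^ (2 ^ i) / (1 - fps_X ^ (2 ^ (i + 1))) *
      (\<Prod>t<i. 1 + 2 * fps_X ^ (2 ^ t) / (1 - fps_X ^ (2 ^ (t + 1)))) :: rat fps)"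
  shows "T sums sp_fps"
proof -
  define P :: "nat \<Rightarrow> rat fps" where
    "P = (\<lambda>i. \<Prod>t<i. 1 + 2 * fps_X ^ (2 ^ t) / (1 - fps_X ^ (2 ^ (t + 1))))"
  \<comment> \<open>The identity is exact after \<open>N\<close> substitutions; \<open>P N\<close>
    collects the factors in front of the remainder.\<close>
  have split: "sp_fps = (\<Sum>i<N. T i) + P N * (sp_fps oo fps_X ^ (2 ^ N))" for N
  proof (induction N)
    case 0
    then show ?case by (simp add: P_def)
  next
    case (Suc N)
    let ?a = "fps_X ^ (2 ^ N) / (1 - fps_X ^ (2 ^ (N + 1))) :: rat fps"
    let ?b = "1 + 2 * fps_X ^ (2 ^ N) / (1 - fps_X ^ (2 ^ (N + 1))) :: rat fps"
    let ?G = "sp_fps oo fps_X ^ (2 ^ Suc N)"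
    have "sp_fps = (\<Sum>i<N. T i) + P N * (?a + ?b * ?G)"
      using Suc unfolding sp_fps_equation_power[of N] Suc_eq_plus1 .
    also have "\<dots> = (\<Sum>i<N. T i) + ?a * P N + P N * ?b * ?G"
      by (simp only: distrib_left mult_ac add_ac)
    also have "?a * P N = T N"
      by (simp only: T_def P_def)
    also have "P N * ?b = P (Suc N)"
      unfolding P_def by (simp only: prod.lessThan_Suc)
    finally show ?case
      by (simp only: sum.lessThan_Suc)
  qed
  show ?thesis
    unfolding sums_def
  \<comment> \<open>Convergence of formal power series is coefficientwise: each coefficient of the
    partial sums is eventually constant.\<close>
  proof (rule tendsto_fpsI)
    fix n
    have "(\<Sum>i<N. T i) $ n = sp_fps $ n" if "N \<ge> n" for N
    proof -
      have "(sp_fps oo fps_X ^ (2 ^ N)) $ k = 0" if "k \<le> n" for k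
      proof -
        \<comment> \<open>Below \<open>2 ^ N\<close> the only multiple of \<open>2 ^ N\<close> is 0,
          and there \<open>sp_fps\<close> has coefficient 0.\<close>
        have "k < 2 ^ N" using that \<open>N \<ge> n\<close> less_exp[of N] by linarith
        then show ?thesis by (auto simp: fps_compose_X_power_nth sp_fps_nth)
      qed
      then have "(P N * (sp_fps oo fps_X ^ (2 ^ N))) $ n = 0"
        by (simp add: fps_mult_nth)
      then show ?thesis
        using split[of N] by (metis add.right_neutral fps_add_nth)
    qed
    then show "eventually (\<lambda>N. (\<Sum>i<N. T i) $ n = sp_fps $ n) sequentially"
      by (auto simp: eventually_sequentially)
  qed
qed

text \<open>Convergence is part of the claim, since \<open>suminf\<close> is informative only for a
  summable series.\<close>

theorem theorem1p2:
  defines "T \<equiv> (\<lambda>i. fps_X ^ (2 ^ i) / (1 - fps_X ^ (2 ^ (i + 1))) *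
      (\<Prod>t<i. 1 + 2 * fps_X ^ (2 ^ t) / (1 - fps_X ^ (2 ^ (t + 1)))) :: rat fps)"
  shows "(\<forall>n. sp n = oc n) \<and>
    summable T \<and>
    Abs_fps (\<lambda>n. of_nat (sp n)) = 1 + (\<Sum>i. T i) \<and>
    1 + (\<Sum>i. T i) = Abs_fps (\<lambda>n. of_nat (oc n))"
proof -
  have sums: "T sums sp_fps"
    unfolding T_def by (rule sums_sp_fps)
  have sp: "Abs_fps (\<lambda>n. of_nat (sp n)) = 1 + (\<Sum>i. T i)"
    by (simp add: sums_unique[OF sums, symmetric] sp_fps_def)
  then show ?thesis
    using sums_summable[OF sums] by (simp add: sp_eq_oc)
qed

end
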